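(* Let $d,n,g,r,k,l\in\mathbb N$ and let $\Psi:\mathcal M(\mathbb C)_{kdg}\to\mathcal M(\mathbb C)_{lnr}$ be a quantum superchannel between multimeters that admits a realization $(s,\Lambda,\tilde\nu)$ with a classical ancilla. Then $\Psi$ is a trash-and-prepare map if and only if it admits a (possibly different) realization $(s,\Lambda,\nu)$ with a classical ancilla such that all the conditional probability distributions $\nu=\{\nu_{\cdot|a,x,y,\lambda}\}_{a\in[k],x\in[g],y\in[r],\lambda\in[s]}$ on $[l]$ are independent of $a\in[k]$. Furthermore, if $s=1$, then we can take $\nu=\tilde\nu$.
   Context: Notation: $[m]=\{1,\dots,m\}$; $\mathcal M(\mathbb C)_m$ is the set of complex $m\times m$ matrices. $\mathfrak M(k,\mathbb C^d)$ is the set of $k$-outcome POVMs on $\mathbb C^d$. $\mathfrak I(m,\mathbb C^n,\mathbb C^d)$ is the set of $m$-outcome instruments: tuples $(\Lambda_j)_{j}$ of $m$ completely positive (CP) maps $\mathcal M(\mathbb C)_n\to\mathcal M(\mathbb C)_d$ whose sum is trace-preserving. $\Lambda^*$ is the dual map: $\mathrm{Tr}[\Lambda^*(A)X]=\mathrm{Tr}[A\Lambda(X)]$. A conditional probability distribution on $[m]$ is a family of probability distributions on $[m]$ indexed by the conditioning variables. A multimeter is a collection $M=\{M_{\cdot|x}\}_{x\in[g]}\subset\mathfrak M(k,\mathbb C^d)$. Its multimeter channel $\Phi_M:\mathcal M(\mathbb C)_{dg}\to\mathcal M(\mathbb C)_k$ is $\Phi_M(\sigma)=\sum_{x,a}\mathrm{Tr}[(M_{a|x}\otimes|x\rangle\langle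 x|)\sigma]|a\rangle\langle a|$, with Choi matrix $J_{\Phi_M}=\sum_{x,a}|a\rangle\langle a|\otimes M_{a|x}^T\otimes|x\rangle\langle x|\in\mathcal M(\mathbb C)_{kdg}$ (fixed orthonormal bases). A quantum superchannel (transformation) between multimeters is a CP map $\Psi:\mathcal M(\mathbb C)_{kdg}\to\mathcal M(\mathbb C)_{lnr}$ which maps the Choi matrix $J_{\Phi_M}$ of every multimeter $M=\{M_{\cdot|x}\}_{x\in[g]}\subset\mathfrak M(k,\mathbb C^d)$ to the Choi matrix $J_{\Phi_N}$ of some multimeter $N=\{N_{\cdot|y}\}_{y\in[r]}\subset\mathfrak M(l,\mathbb C^n)$. A realization of $\Psi$ with a classical ancilla is a triple $(s,\Lambda,\nu)$ where $s\in\mathbb N$, $\Lambda=\{\Lambda_{\cdot,\cdot|y}\}_{y\in[r]}\subset\mathfrak I(g\cdot s,\mathbb C^n,\mathbb C^d)$ is a set of instruments with outcomes $(x,\lambda)\in[g]\times[s]$, and $\nu=(\nu_{\cdot|a,x,y,\lambda})_{a\in[k],x\in[g],y\in[r],\lambda\in[s]}$ is a conditional probability distribution on $[l]$, such that for every multimeter $M\subset\mathfrak M(k,\mathbb C^d)$, $\Psi(J_{\Phi_M})=J_{\Phi_N}$ with $N_{b|y}=\sum_{x=1}^g\sum_{a=1}^k\sum_{\lambda=1}^s\nu_{b|a,x,y,\lambda}\Lambda^*_{x,\lambda|y}(M_{a|x})$. $\Psi$ is trash-and-prepare if there is a fixed multimeter $N=\{N_{\cdot|y}\}_{y\in[r]}\subset\mathfrak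 M(l,\mathbb C^n)$ such that $\Psi(J_{\Phi_M})=J_{\Phi_N}$ for all multimeters $M=\{M_{\cdot|x}\}_{x\in[g]}\subset\mathfrak M(k,\mathbb C^d)$.
   Formalization: For s=1, ν = ν̃ is asserted only at those (x,y) with Λ_{x,1|y} ≠ 0; where an instrument element is the zero map, ν̃ is arbitrary and may depend on a, so the claim as written fails there. *)

theory Defs
  imports "HOL-Probability.Probability" "HOL-Library.Nonpos_Ints"
begin

text \<open>
  The spaces \<open>\<complex>\<^sup>d\<close> and the index sets \<open>[k]\<close> are indexed by (nonempty) finite types, so complex
  \<open>d \<times> d\<close> matrices have type \<open>complex^'d^'d\<close>, and a tensor product of spaces is indexed by the
  product of the index types: \<open>kdg \<times> kdg\<close> matrices have type
  \<open>complex^('k \<times> 'd \<times> 'g)^('k \<times> 'd \<times> 'g)\<close>.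
\<close>

definition cscale :: "complex \<Rightarrow> complex^'n^'m \<Rightarrow> complex^'n^'m" where
  "cscale c A = (\<chi> i j. c * A $ i $ j)"

definition kron :: "complex^'n^'m \<Rightarrow> complex^'q^'p \<Rightarrow> complex^('n \<times> 'q)^('m \<times> 'p)"
    (infixr \<open>\<otimes>\<^sub>K\<close> 75) where
  "A \<otimes>\<^sub>K B = (\<chi> i j. A $ fst i $ fst j * B $ snd i $ snd j)"

text \<open>\<open>ketbra i j\<close> is \<open>|i\<rangle>\<langle>j|\<close>.\<close>

definition ketbra :: "'m \<Rightarrow> 'n \<Rightarrow> complex^'n^'m" where
  "ketbra i j = (\<chi> p q. if p = i \<and> q = j then 1 else 0)"

text \<open>\<open>cform u A v\<close> is \<open>\<langle>u, A v\<rangle>\<close>.\<close>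

definition cform :: "complex^'n \<Rightarrow> complex^'n^'n \<Rightarrow> complex^'n \<Rightarrow> complex" where
  "cform u A v = (\<Sum>p\<in>UNIV. \<Sum>q\<in>UNIV. cnj (u $ p) * A $ p $ q * v $ q)"

definition psd :: "complex^'n^'n \<Rightarrow> bool" where
  "psd A \<longleftrightarrow> (\<forall>v. cform v A v \<in> \<real>\<^sub>\<ge>\<^sub>0)"

text \<open>
  Positivity of the element \<open>\<Sum>i j<m. |i\<rangle>\<langle>j| \<otimes> X i j\<close> of the \<open>m \<times> m\<close> matrices over \<open>complex^'n^'n\<close>.
  The size \<open>m\<close> is a number here (not a type) because complete positivity quantifies over it.
\<close>

definition block_psd :: "nat \<Rightarrow> (nat \<Rightarrow> nat \<Rightarrow> complex^'n^'n) \<Rightarrow> bool" where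
  "block_psd m X \<longleftrightarrow>
     (\<forall>v. (\<Sum>i<m. \<Sum>j<m. cform (v i) (X i j) (v j)) \<in> \<real>\<^sub>\<ge>\<^sub>0)"

definition clinear_map :: "(complex^'n^'n \<Rightarrow> complex^'m^'m) \<Rightarrow> bool" where
  "clinear_map \<Phi> \<longleftrightarrow>
     (\<forall>X Y. \<Phi> (X + Y) = \<Phi> X + \<Phi> Y) \<and> (\<forall>c X. \<Phi> (cscale c X) = cscale c (\<Phi> X))"

definition completely_positive :: "(complex^'n^'n \<Rightarrow> complex^'m^'m) \<Rightarrow> bool" where
  "completely_positive \<Phi> \<longleftrightarrow>
     clinear_map \<Phi> \<and> (\<forall>m X. block_psd m X \<longrightarrow> block_psd m (\<lambda>i j. \<Phi> (X i j)))"

definition povm :: "('k::finite \<Rightarrow> complex^'d^'d) \<Rightarrow> bool" where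
  "povm E \<longleftrightarrow> (\<forall>a. psd (E a)) \<and> (\<Sum>a\<in>UNIV. E a) = mat 1"

text \<open>\<open>M x a\<close> is \<open>M\<^bsub>a|x\<^esub>\<close>.\<close>

definition multimeter :: "('g \<Rightarrow> 'k::finite \<Rightarrow> complex^'d^'d) \<Rightarrow> bool" where
  "multimeter M \<longleftrightarrow> (\<forall>x. povm (M x))"

definition multimeter_channel ::
    "('g::finite \<Rightarrow> 'k::finite \<Rightarrow> complex^'d^'d)
       \<Rightarrow> complex^('d \<times> 'g)^('d \<times> 'g) \<Rightarrow> complex^'k^'k" where
  "multimeter_channel M \<sigma> =
     (\<Sum>x\<in>UNIV. \<Sum>a\<in>UNIV. cscale (trace ((M x a \<otimes>\<^sub>K ketbra x x) ** \<sigma>)) (ketbra a a))"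

definition choi :: "(complex^'n^'n \<Rightarrow> complex^'m^'m) \<Rightarrow> complex^('m \<times> 'n)^('m \<times> 'n)" where
  "choi \<Phi> = (\<Sum>i\<in>UNIV. \<Sum>j\<in>UNIV. \<Phi> (ketbra i j) \<otimes>\<^sub>K ketbra i j)"

definition multimeter_choi ::
    "('g::finite \<Rightarrow> 'k::finite \<Rightarrow> complex^'d^'d)
       \<Rightarrow> complex^('k \<times> 'd \<times> 'g)^('k \<times> 'd \<times> 'g)" where
  "multimeter_choi M = choi (multimeter_channel M)"

definition superchannel ::
    "(complex^('k::finite \<times> 'd::finite \<times> 'g::finite)^('k \<times> 'd \<times> 'g)
       \<Rightarrow> complex^('l::finite \<times> 'n::finite \<times> 'r::finite)^('l \<times> 'n \<times> 'r)) \<Rightarrow> bool" where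
  "superchannel \<Psi> \<longleftrightarrow> completely_positive \<Psi> \<and>
     (\<forall>M. multimeter M \<longrightarrow>
        (\<exists>N. multimeter N \<and> \<Psi> (multimeter_choi M) = multimeter_choi N))"

definition trash_and_prepare ::
    "(complex^('k::finite \<times> 'd::finite \<times> 'g::finite)^('k \<times> 'd \<times> 'g)
       \<Rightarrow> complex^('l::finite \<times> 'n::finite \<times> 'r::finite)^('l \<times> 'n \<times> 'r)) \<Rightarrow> bool" where
  "trash_and_prepare \<Psi> \<longleftrightarrow>
     (\<exists>N. multimeter N \<and>
        (\<forall>M. multimeter M \<longrightarrow> \<Psi> (multimeter_choi M) = multimeter_choi N))"

definition instrument :: "'j set \<Rightarrow> ('j \<Rightarrow> complex^'n^'n \<Rightarrow> complex^'d^'d) \<Rightarrow> bool" where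
  "instrument J \<Lambda> \<longleftrightarrow> finite J \<and> (\<forall>j\<in>J. completely_positive (\<Lambda> j)) \<and>
     (\<forall>X. trace (\<Sum>j\<in>J. \<Lambda> j X) = trace X)"

definition dual_map ::
    "(complex^'n^'n \<Rightarrow> complex^'d^'d) \<Rightarrow> complex^'d^'d \<Rightarrow> complex^'n^'n" where
  "dual_map \<Lambda> = (THE \<Lambda>'. \<forall>A X. trace (\<Lambda>' A ** X) = trace (A ** \<Lambda> X))"

text \<open>
  \<open>\<Lambda> y (x, c)\<close> is \<open>\<Lambda>\<^bsub>x,c|y\<^esub>\<close> and \<open>pmf (\<nu> a x y c) b\<close> is \<open>\<nu>\<^bsub>b|a,x,y,c\<^esub>\<close>; the classical
  ancilla \<open>c\<close> ranges over \<open>{1..s}\<close>, and values at other \<open>c\<close> are irrelevant.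
\<close>

definition classical_realization ::
    "(complex^('k::finite \<times> 'd::finite \<times> 'g::finite)^('k \<times> 'd \<times> 'g)
       \<Rightarrow> complex^('l::finite \<times> 'n::finite \<times> 'r::finite)^('l \<times> 'n \<times> 'r))
     \<Rightarrow> nat \<Rightarrow> ('r \<Rightarrow> 'g \<times> nat \<Rightarrow> complex^'n^'n \<Rightarrow> complex^'d^'d)
     \<Rightarrow> ('k \<Rightarrow> 'g \<Rightarrow> 'r \<Rightarrow> nat \<Rightarrow> 'l pmf) \<Rightarrow> bool" where
  "classical_realization \<Psi> s \<Lambda> \<nu> \<longleftrightarrow>
     (\<forall>y. instrument (UNIV \<times> {1..s}) (\<Lambda> y)) \<and>
     (\<forall>M. multimeter M \<longrightarrow>
        \<Psi> (multimeter_choi M) =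
        multimeter_choi (\<lambda>y b. \<Sum>x\<in>UNIV. \<Sum>a\<in>UNIV. \<Sum>c=1..s.
          pmf (\<nu> a x y c) b *\<^sub>R dual_map (\<Lambda> y (x, c)) (M x a)))"

text \<open>
  An instrument may contain the zero map. If \<open>\<Lambda>\<^bsub>x,c|y\<^esub> = 0\<close>, then
  \<open>\<nu>\<^bsub>b|a,x,y,c\<^esub>\<close> does not contribute to the realization and is not determined by it,
  so two \<open>\<nu>\<close> can only be compared at the nonzero \<open>\<Lambda>\<^bsub>x,c|y\<^esub>\<close>.
\<close>

definition independent_of_outcome ::
    "nat \<Rightarrow> ('k \<Rightarrow> 'g \<Rightarrow> 'r \<Rightarrow> nat \<Rightarrow> 'l pmf) \<Rightarrow> bool" where
  "independent_of_outcome s \<nu> \<longleftrightarrow>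
     (\<forall>x y. \<forall>c\<in>{1..s}. \<forall>a a'. \<nu> a x y c = \<nu> a' x y c)"

lemma ketbra_nth: "ketbra i j $ p $ q = (if p = i \<and> q = j then 1 else 0)"
  by (simp add: ketbra_def)

lemma kron_nth: "(A \<otimes>\<^sub>K B) $ p $ q = A $ fst p $ fst q * B $ snd p $ snd q"
  by (simp add: kron_def)

lemma cscale_nth: "cscale c A $ p $ q = c * A $ p $ q"
  by (simp add: cscale_def)

lemma trace_mult_ketbra: "trace (A ** ketbra i j) = A $ j $ i"
proof -
  have "A $ p $ k * (if k = i \<and> p = j then 1 else 0)
      = (if k = i then (if p = j then A $ p $ k else 0) else 0)" for p k
    by simp
  then show ?thesis
    by (simp add: trace_def matrix_matrix_mult_def ketbra_def)
qed

lemma choi_nth: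
  "choi \<Phi> $ p $ q = \<Phi> (ketbra (snd p) (snd q)) $ fst p $ fst q"
proof -
  have "choi \<Phi> $ p $ q = (\<Sum>i\<in>UNIV. \<Sum>j\<in>UNIV.
      if i = snd p then (if j = snd q then \<Phi> (ketbra i j) $ fst p $ fst q else 0) else 0)"
    unfolding choi_def sum_component kron_nth ketbra_nth by (intro sum.cong refl) auto
  also have "\<dots> = (\<Sum>i\<in>UNIV. if i = snd p then
      (\<Sum>j\<in>UNIV. if j = snd q then \<Phi> (ketbra i j) $ fst p $ fst q else 0) else 0)"
    by (intro sum.cong refl) auto
  finally show ?thesis by simp
qed

lemma multimeter_choi_eq:
  "multimeter_choi M =
     (\<Sum>x\<in>UNIV. \<Sum>a\<in>UNIV. ketbra a a \<otimes>\<^sub>K transpose (M x a) \<otimes>\<^sub>K ketbra x x)"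
proof -
  have "multimeter_choi M $ p $ q =
     (\<Sum>x\<in>UNIV. \<Sum>a\<in>UNIV. ketbra a a \<otimes>\<^sub>K transpose (M x a) \<otimes>\<^sub>K ketbra x x) $ p $ q" for p q
    unfolding multimeter_choi_def choi_nth multimeter_channel_def trace_mult_ketbra
      sum_component cscale_nth kron_nth ketbra_nth
    by (intro sum.cong refl) (auto simp: transpose_def)
  then show ?thesis by (simp add: vec_eq_iff)
qed

lemma clinear_map_sum:
  assumes "clinear_map \<Lambda>"
  shows "\<Lambda> (\<Sum>i\<in>I. f i) = (\<Sum>i\<in>I. \<Lambda> (f i))"
proof -
  have add: "\<Lambda> (X + Y) = \<Lambda> X + \<Lambda> Y" for X Y
    using assms by (simp add: clinear_map_def)
  then have "\<Lambda> 0 = 0" by (metis add_cancel_right_right)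
  with add show ?thesis by (induction I rule: infinite_finite_induct) simp_all
qed

lemma matrix_ketbra_expansion:
  "X = (\<Sum>i\<in>UNIV. \<Sum>j\<in>UNIV. cscale (X $ i $ j) (ketbra i j))"
proof -
  have "(\<Sum>i\<in>UNIV. \<Sum>j\<in>UNIV. cscale (X $ i $ j) (ketbra i j)) $ p $ q = X $ p $ q" for p q
  proof -
    have "(\<Sum>i\<in>UNIV. \<Sum>j\<in>UNIV. cscale (X $ i $ j) (ketbra i j)) $ p $ q =
        (\<Sum>i\<in>UNIV. if i = p then (\<Sum>j\<in>UNIV. if j = q then X $ i $ j else 0) else 0)"
      unfolding sum_component cscale_nth ketbra_nth
      by (intro sum.cong refl) (auto simp: if_distrib cong: if_cong)
    then show ?thesis by simp
  qed
  then show ?thesis by (simp add: vec_eq_iff)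
qed

lemma trace_mult_eq: "trace (A ** B) = (\<Sum>i\<in>UNIV. \<Sum>j\<in>UNIV. A $ i $ j * B $ j $ i)"
  by (simp add: trace_def matrix_matrix_mult_def)

lemma trace_mult_cscale: "trace (A ** cscale c X) = c * trace (A ** X)"
  by (simp add: trace_mult_eq cscale_nth sum_distrib_left mult.left_commute)

lemma trace_mult_sum: "trace (A ** (\<Sum>i\<in>I. f i)) = (\<Sum>i\<in>I. trace (A ** f i))"
proof -
  have "trace (A ** (\<Sum>i\<in>I. f i)) = (\<Sum>p\<in>UNIV. \<Sum>q\<in>UNIV. \<Sum>i\<in>I. A $ p $ q * f i $ q $ p)"
    by (simp add: trace_mult_eq sum_distrib_left)
  also have "\<dots> = (\<Sum>p\<in>UNIV. \<Sum>i\<in>I. \<Sum>q\<in>UNIV. A $ p $ q * f i $ q $ p)"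
    by (intro sum.cong refl sum.swap)
  also have "\<dots> = (\<Sum>i\<in>I. \<Sum>p\<in>UNIV. \<Sum>q\<in>UNIV. A $ p $ q * f i $ q $ p)"
    by (rule sum.swap)
  finally show ?thesis by (simp add: trace_mult_eq)
qed

lemma dual_map_adjoint:
  assumes "clinear_map \<Lambda>"
  shows "trace (dual_map \<Lambda> A ** X) = trace (A ** \<Lambda> X)"
proof -
  let ?P = "\<lambda>\<Lambda>'. \<forall>A X. trace (\<Lambda>' A ** X) = trace (A ** \<Lambda> X)"
  define L where "L A = (\<chi> i j. trace (A ** \<Lambda> (ketbra j i)))" for A
  have scale: "\<Lambda> (cscale c Y) = cscale c (\<Lambda> Y)" for c Y
    using assms by (simp add: clinear_map_def)
  have "?P L"
  proof (intro allI)
    fix A X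
    have "trace (L A ** X) =
        trace (L A ** (\<Sum>i\<in>UNIV. \<Sum>j\<in>UNIV. cscale (X $ i $ j) (ketbra i j)))"
      using matrix_ketbra_expansion[of X] by simp
    also have "\<dots> = (\<Sum>i\<in>UNIV. \<Sum>j\<in>UNIV. X $ i $ j * trace (A ** \<Lambda> (ketbra i j)))"
      by (simp add: trace_mult_sum trace_mult_cscale trace_mult_ketbra L_def)
    also have "\<dots> = trace (A ** \<Lambda> (\<Sum>i\<in>UNIV. \<Sum>j\<in>UNIV. cscale (X $ i $ j) (ketbra i j)))"
      by (simp add: clinear_map_sum[OF assms] scale trace_mult_sum trace_mult_cscale)
    also have "\<dots> = trace (A ** \<Lambda> X)"
      using matrix_ketbra_expansion[of X] by simp
    finally show "trace (L A ** X) = trace (A ** \<Lambda> X)" .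
  qed
  moreover have "\<Lambda>' = L" if "?P \<Lambda>'" for \<Lambda>'
  proof
    fix A
    have "\<Lambda>' A $ i $ j = L A $ i $ j" for i j
      using that[rule_format, of A "ketbra j i"] by (simp add: trace_mult_ketbra L_def)
    then show "\<Lambda>' A = L A" by (simp add: vec_eq_iff)
  qed
  ultimately have "?P (dual_map \<Lambda>)"
    unfolding dual_map_def by (rule theI[where P = ?P])
  then show ?thesis by blast
qed

end

theory Submission
  imports Defs
begin

text \<open>
  If the post-processing does not depend on the outcome \<open>a\<close>, the simulated multimeter only sees
  \<open>\<Sum>\<^sub>a M\<^bsub>a|x\<^esub> = 1\<close>. Conversely, feeding the deterministic multimeter
  that always outputs a fixed \<open>a\<^sub>0\<close> into a trash-and-prepare map shows that
  \<open>\<nu>'\<^bsub>b|a,x,y,c\<^esub>\<close> may be replaced by \<open>\<nu>'\<^bsub>b|a\<^sub>0,x,y,c\<^esub>\<close>. For \<open>s = 1\<close>, changing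
  the deterministic output at a single \<open>x\<close> from \<open>a\<^sub>0\<close> to \<open>a\<close> changes the simulated multimeter by
  \<open>(\<nu>'\<^bsub>b|a,x,y,1\<^esub> - \<nu>'\<^bsub>b|a\<^sub>0,x,y,1\<^esub>) \<Lambda>\<^sup>*\<^bsub>x,1|y\<^esub>(1)\<close>, and \<open>\<Lambda>\<^sup>*(1) = 0\<close> forces a
  completely positive \<open>\<Lambda>\<close> to vanish.
\<close>

section \<open>The trace pairing, dual maps and Choi matrices\<close>

lemma trace_pairing_eqI:
  fixes A B :: "complex^'n^'n"
  assumes "\<And>X. trace (A ** X) = trace (B ** X)"
  shows "A = B"
proof -
  have "A $ i $ j = B $ i $ j" for i j
    using assms[of "ketbra j i"] by (simp add: trace_mult_ketbra)
  then show ?thesis by (simp add: vec_eq_iff)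
qed

text \<open>\<open>dual_map\<close> is a definite description, accessible only through its adjoint
  identity, so additivity is tested against every \<open>X\<close> under the nondegenerate trace
  pairing.\<close>

lemma dual_map_sum:
  assumes "clinear_map \<Lambda>"
  shows "dual_map \<Lambda> (\<Sum>i\<in>I. f i) = (\<Sum>i\<in>I. dual_map \<Lambda> (f i))"
proof (rule trace_pairing_eqI)
  fix X
  have sum: "trace ((\<Sum>i\<in>I. h i) ** Y) = (\<Sum>i\<in>I. trace (h i ** Y))"
    for h :: "_ \<Rightarrow> complex^'m^'m" and Y
    by (simp add: trace_mul_sym[of _ Y] trace_mult_sum)
  show "trace (dual_map \<Lambda> (\<Sum>i\<in>I. f i) ** X) = trace ((\<Sum>i\<in>I. dual_map \<Lambda> (f i)) ** X)"
    by (simp add: dual_map_adjoint[OF assms] sum)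
qed

lemma dual_map_zero: "clinear_map \<Lambda> \<Longrightarrow> dual_map \<Lambda> 0 = 0"
  using dual_map_sum[of \<Lambda> _ "{}"] by simp

text \<open>The blocks diagonal in outcome and setting recover each effect, with \<open>i\<close>
  and \<open>j\<close> swapped by the transpose. This makes the Choi matrix determine the
  multimeter.\<close>

lemma multimeter_choi_nth:
  "multimeter_choi M $ (a, i, x) $ (a, j, x) = M x a $ j $ i"
proof -
  have "multimeter_choi M $ (a, i, x) $ (a, j, x) =
      (\<Sum>x'\<in>UNIV. \<Sum>a'\<in>UNIV. if x' = x then if a' = a then M x' a' $ j $ i else 0 else 0)"
    unfolding multimeter_choi_eq sum_component kron_nth ketbra_nth
    by (intro sum.cong refl) (auto simp: transpose_def)
  also have "\<dots> = (\<Sum>x'\<in>UNIV. if x' = x then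
      \<Sum>a'\<in>UNIV. if a' = a then M x' a' $ j $ i else 0 else 0)"
    by (intro sum.cong refl) auto
  finally show ?thesis by simp
qed

lemma multimeter_choi_inj:
  assumes "multimeter_choi M = multimeter_choi N"
  shows "M = N"
proof (intro ext)
  fix x a
  show "M x a = N x a"
    using assms multimeter_choi_nth[of M a _ x] multimeter_choi_nth[of N a _ x]
    by (simp add: vec_eq_iff)
qed

section \<open>Positive matrices and vanishing completely positive maps\<close>

lemma cform_add_left: "cform (u + v) A w = cform u A w + cform v A w"
  by (simp add: cform_def algebra_simps sum.distrib)

lemma cform_add_right: "cform u A (v + w) = cform u A v + cform u A w"
  by (simp add: cform_def algebra_simps sum.distrib)

lemma cform_axis: "cform (axis p b) A (axis q c) = cnj b * A $ p $ q * c"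
proof -
  have "cform (axis p b) A (axis q c) = (\<Sum>i\<in>UNIV. \<Sum>j\<in>UNIV.
      if i = p then if j = q then cnj b * A $ i $ j * c else 0 else 0)"
    unfolding cform_def axis_def by (intro sum.cong refl) auto
  also have "\<dots> = (\<Sum>i\<in>UNIV. if i = p then
      \<Sum>j\<in>UNIV. if j = q then cnj b * A $ i $ j * c else 0 else 0)"
    by (intro sum.cong refl) auto
  finally show ?thesis by simp
qed

text \<open>The diagonal entries are nonnegative with sum zero, hence zero; positivity on
  combinations of two basis vectors then kills the off-diagonal entries.\<close>

lemma psd_trace_zero:
  fixes A :: "complex^'n^'n"
  assumes psd: "psd A" and tr: "trace A = 0"
  shows "A = 0"
proof -
  have nonneg: "0 \<le> Re (cform v A v)" and real: "Im (cform v A v) = 0" for v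
    using psd by (auto simp: psd_def complex_nonneg_Reals_iff)
  have "0 \<le> Re (A $ p $ p)" and im: "Im (A $ p $ p) = 0" for p
    using nonneg[of "axis p 1"] real[of "axis p 1"] by (simp_all add: cform_axis)
  moreover have "(\<Sum>p\<in>UNIV. Re (A $ p $ p)) = 0"
    using arg_cong[OF tr, of Re] by (simp add: trace_def)
  ultimately have diag: "A $ p $ p = 0" for p
    by (simp add: sum_nonneg_eq_0_iff complex_eq_iff)
  have form: "cform (axis p 1 + axis q c) A (axis p 1 + axis q c)
      = A $ p $ q * c + cnj c * A $ q $ p" for p q c
    by (simp add: cform_add_left cform_add_right cform_axis diag)
  have "A $ p $ q = 0" for p q
  proof -
    have bounds: "0 \<le> Re (A $ p $ q * c + cnj c * A $ q $ p)"
        "Im (A $ p $ q * c + cnj c * A $ q $ p) = 0" for c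
      using nonneg[of "axis p 1 + axis q c"] real[of "axis p 1 + axis q c"]
      unfolding form by simp_all
    \<comment> \<open>The form is odd in \<open>c\<close>, so its real part vanishes too. The values
      1 and -1 give \<open>A $ p $ q + A $ q $ p = 0\<close>, and the imaginary values give
      \<open>A $ p $ q = A $ q $ p\<close>.\<close>
    show ?thesis
      using bounds[of 1] bounds[of "-1"] bounds[of \<i>] bounds[of "-\<i>"]
      by (simp add: complex_eq_iff)
  qed
  then show ?thesis by (simp add: vec_eq_iff)
qed

text \<open>Ordinary positivity is the case of block size 1.\<close>

lemma completely_positive_psd:
  fixes \<Lambda> :: "complex^'n^'n \<Rightarrow> complex^'m^'m"
  assumes "completely_positive \<Lambda>" and "psd X"
  shows "psd (\<Lambda> X)"
proof -
  have "block_psd 1 (\<lambda>_ _. X)"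
    using \<open>psd X\<close> by (auto simp: psd_def block_psd_def)
  then have "block_psd 1 (\<lambda>_ _. \<Lambda> X)"
    using assms(1) unfolding completely_positive_def by blast
  then have "(\<Sum>i<1::nat. \<Sum>j<1::nat. cform v (\<Lambda> X) v) \<in> \<real>\<^sub>\<ge>\<^sub>0" for v :: "complex^'m"
    unfolding block_psd_def by (elim allE[where x = "\<lambda>_::nat. v"])
  then show ?thesis by (simp add: psd_def)
qed

definition rank_one :: "complex^'n \<Rightarrow> complex^'n^'n" where
  "rank_one v = (\<chi> p q. v $ p * cnj (v $ q))"

lemma psd_rank_one: "psd (rank_one v)"
proof -
  have "cform u (rank_one v) u = (\<Sum>p\<in>UNIV. cnj (u $ p) * v $ p) * cnj (\<Sum>p\<in>UNIV. cnj (u $ p) * v $ p)"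
    for u
    unfolding cform_def rank_one_def cnj_sum sum_product by (simp add: mult_ac)
  moreover have "z * cnj z \<in> \<real>\<^sub>\<ge>\<^sub>0" for z
    by (metis complex_norm_square nonneg_Reals_of_real_iff zero_le_power2)
  ultimately show ?thesis unfolding psd_def by metis
qed

text \<open>The dual hypothesis says that every output has trace zero, so outputs of positive inputs
  vanish. Polarisation passes from \<open>rank_one v\<close> to all matrix units.\<close>

lemma completely_positive_eq_zero:
  assumes cp: "completely_positive \<Lambda>" and dual: "dual_map \<Lambda> (mat 1) = 0"
  shows "\<Lambda> = (\<lambda>X. 0)"
proof -
  have lin: "clinear_map \<Lambda>" using cp by (simp add: completely_positive_def)
  then have scale: "\<Lambda> (cscale c Y) = cscale c (\<Lambda> Y)" for c Y
    by (simp add: clinear_map_def)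
  have "trace (\<Lambda> X) = 0" for X
    using dual_map_adjoint[OF lin, of "mat 1" X] dual by (simp add: trace_def)
  then have rank_one: "\<Lambda> (rank_one v) = 0" for v
    by (intro psd_trace_zero completely_positive_psd[OF cp] psd_rank_one)
  have expand: "\<Lambda> X $ i $ j = (\<Sum>p\<in>UNIV. \<Sum>q\<in>UNIV. X $ p $ q * \<Lambda> (ketbra p q) $ i $ j)" for X i j
    using arg_cong[OF matrix_ketbra_expansion[of X], of "\<lambda>Y. \<Lambda> Y $ i $ j"]
    by (simp add: clinear_map_sum[OF lin] scale cscale_nth)
  have "\<Lambda> (ketbra p q) $ i $ j = 0" for p q i j
  proof -
    \<comment> \<open>The indices are swapped so that the form of \<open>C\<close> at
      \<open>v\<close> is one fixed entry of \<open>\<Lambda> (rank_one v)\<close>.\<close>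
    define C where "C = (\<chi> q p. \<Lambda> (ketbra p q) $ i $ j)"
    have form: "cform v C v = 0" for v
    proof -
      have "cform v C v = (\<Sum>q\<in>UNIV. \<Sum>p\<in>UNIV. rank_one v $ p $ q * \<Lambda> (ketbra p q) $ i $ j)"
        by (simp add: cform_def C_def rank_one_def mult_ac)
      also have "\<dots> = \<Lambda> (rank_one v) $ i $ j"
        by (subst expand) (rule sum.swap)
      finally show ?thesis using rank_one by simp
    qed
    have "C $ p $ p = 0" for p
      using form[of "axis p 1"] by (simp add: cform_axis)
    \<comment> \<open>A form that vanishes identically is in particular positive, so the
      polarisation in \<open>psd_trace_zero\<close> can be reused.\<close>
    then have "C = 0"
      by (intro psd_trace_zero) (simp_all add: psd_def form trace_def)
    then have "C $ q $ p = 0" by simp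
    then show ?thesis by (simp add: C_def)
  qed
  then have "\<Lambda> X $ i $ j = 0" for X i j
    by (subst expand) simp
  then show ?thesis by (simp add: vec_eq_iff fun_eq_iff)
qed

section \<open>Deterministic and simulated multimeters\<close>

definition deterministic_multimeter :: "('g \<Rightarrow> 'k) \<Rightarrow> 'g \<Rightarrow> 'k::finite \<Rightarrow> complex^'d^'d" where
  "deterministic_multimeter f x a = (if a = f x then mat 1 else 0)"

lemma multimeter_deterministic: "multimeter (deterministic_multimeter f :: 'g \<Rightarrow> 'k::finite \<Rightarrow> complex^'d^'d)"
proof -
  have "cform v (mat 1 :: complex^'d^'d) v = of_real (\<Sum>p\<in>UNIV. (cmod (v $ p))\<^sup>2)" for v
    by (auto simp: cform_def mat_def if_distrib if_distribR complex_norm_square mult_ac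
        simp del: of_real_power cong: if_cong intro!: sum.cong)
  then have "psd (mat 1 :: complex^'d^'d)"
    unfolding psd_def by (metis nonneg_Reals_of_real_iff sum_nonneg zero_le_power2)
  moreover have "psd (0 :: complex^'d^'d)" by (simp add: psd_def cform_def)
  ultimately show ?thesis
    by (simp add: multimeter_def povm_def deterministic_multimeter_def)
qed

definition simulated ::
    "nat \<Rightarrow> ('r \<Rightarrow> 'g::finite \<times> nat \<Rightarrow> complex^'n^'n \<Rightarrow> complex^'d^'d)
     \<Rightarrow> ('k::finite \<Rightarrow> 'g \<Rightarrow> 'r \<Rightarrow> nat \<Rightarrow> 'l pmf) \<Rightarrow> ('g \<Rightarrow> 'k \<Rightarrow> complex^'d^'d)
     \<Rightarrow> 'r \<Rightarrow> 'l \<Rightarrow> complex^'n^'n" where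
  "simulated s \<Lambda> \<nu> M y b = (\<Sum>x\<in>UNIV. \<Sum>a\<in>UNIV. \<Sum>c=1..s.
     pmf (\<nu> a x y c) b *\<^sub>R dual_map (\<Lambda> y (x, c)) (M x a))"

lemma classical_realization_iff:
  "classical_realization \<Psi> s \<Lambda> \<nu> \<longleftrightarrow> (\<forall>y. instrument (UNIV \<times> {1..s}) (\<Lambda> y)) \<and>
     (\<forall>M. multimeter M \<longrightarrow> \<Psi> (multimeter_choi M) = multimeter_choi (simulated s \<Lambda> \<nu> M))"
  by (simp add: classical_realization_def simulated_def[abs_def])

lemma instrument_completely_positive:
  assumes "\<forall>y. instrument (UNIV \<times> {1..s}) (\<Lambda> y)" and "c \<in> {1..s}"
  shows "completely_positive (\<Lambda> y (x, c))"
  using assms by (simp add: instrument_def)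

lemma simulated_deterministic:
  assumes "\<forall>y. instrument (UNIV \<times> {1..s}) (\<Lambda> y)"
  shows "simulated s \<Lambda> \<nu> (deterministic_multimeter f) y b =
    (\<Sum>x\<in>UNIV. \<Sum>c=1..s. pmf (\<nu> (f x) x y c) b *\<^sub>R dual_map (\<Lambda> y (x, c)) (mat 1))"
proof -
  \<comment> \<open>Outside \<open>{1..s}\<close> the maps need not be linear, so the range of
    \<open>c\<close> matters here.\<close>
  have zero: "dual_map (\<Lambda> y (x, c)) 0 = 0" if "c \<in> {1..s}" for x c
    using instrument_completely_positive[OF assms that]
    by (intro dual_map_zero) (simp add: completely_positive_def)
  have "(\<Sum>a\<in>UNIV. \<Sum>c=1..s.
        pmf (\<nu> a x y c) b *\<^sub>R dual_map (\<Lambda> y (x, c)) (deterministic_multimeter f x a)) =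
      (\<Sum>a\<in>UNIV. if a = f x then
        \<Sum>c=1..s. pmf (\<nu> a x y c) b *\<^sub>R dual_map (\<Lambda> y (x, c)) (mat 1) else 0)" for x
    by (intro sum.cong refl) (auto simp: deterministic_multimeter_def zero)
  then show ?thesis by (simp add: simulated_def)
qed

text \<open>A weight independent of \<open>a\<close> factors out of the sum over outcomes, and
  additivity of the dual map leaves only the normalisation of \<open>M x\<close>. Hence any
  deterministic multimeter can represent all others.\<close>

lemma simulated_independent:
  assumes inst: "\<forall>y. instrument (UNIV \<times> {1..s}) (\<Lambda> y)"
    and indep: "independent_of_outcome s \<nu>" and M: "multimeter M"
  shows "simulated s \<Lambda> \<nu> M = simulated s \<Lambda> \<nu> (deterministic_multimeter f)"
proof (intro ext)
  fix y b
  have "(\<Sum>a\<in>UNIV. \<Sum>c=1..s. pmf (\<nu> a x y c) b *\<^sub>R dual_map (\<Lambda> y (x, c)) (M x a)) =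
      (\<Sum>c=1..s. pmf (\<nu> (f x) x y c) b *\<^sub>R dual_map (\<Lambda> y (x, c)) (mat 1))" for x
  proof -
    have "(\<Sum>a\<in>UNIV. pmf (\<nu> a x y c) b *\<^sub>R dual_map (\<Lambda> y (x, c)) (M x a)) =
        pmf (\<nu> (f x) x y c) b *\<^sub>R dual_map (\<Lambda> y (x, c)) (mat 1)" if c: "c \<in> {1..s}" for c
    proof -
      have eq: "\<nu> a x y c = \<nu> (f x) x y c" for a
        using indep c unfolding independent_of_outcome_def by blast
      have "(\<Sum>a\<in>UNIV. pmf (\<nu> a x y c) b *\<^sub>R dual_map (\<Lambda> y (x, c)) (M x a)) =
          pmf (\<nu> (f x) x y c) b *\<^sub>R (\<Sum>a\<in>UNIV. dual_map (\<Lambda> y (x, c)) (M x a))"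
        unfolding scaleR_sum_right by (intro sum.cong refl) (metis eq)
      also have "(\<Sum>a\<in>UNIV. dual_map (\<Lambda> y (x, c)) (M x a)) =
          dual_map (\<Lambda> y (x, c)) (\<Sum>a\<in>UNIV. M x a)"
        using instrument_completely_positive[OF inst c]
        by (simp add: completely_positive_def dual_map_sum)
      also have "(\<Sum>a\<in>UNIV. M x a) = mat 1"
        using M by (simp add: multimeter_def povm_def)
      finally show ?thesis .
    qed
    then show ?thesis by (subst sum.swap) simp
  qed
  then show "simulated s \<Lambda> \<nu> M y b = simulated s \<Lambda> \<nu> (deterministic_multimeter f) y b"
    unfolding simulated_deterministic[OF inst] by (simp add: simulated_def)
qed

section \<open>The two directions and the trivial ancilla\<close>

lemma independent_imp_trash_and_prepare:
  assumes "superchannel \<Psi>" and "classical_realization \<Psi> s \<Lambda> \<nu>" and "independent_of_outcome s \<nu>"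
  shows "trash_and_prepare \<Psi>"
proof -
  \<comment> \<open>Both sides are compared with the same deterministic multimeter, whose output
    function \<open>undefined\<close> is an arbitrary choice.\<close>
  have "\<Psi> (multimeter_choi M) = \<Psi> (multimeter_choi M')" if "multimeter M" "multimeter M'" for M M'
    using assms(2,3) that simulated_independent[of s \<Lambda> \<nu> _ undefined]
    unfolding classical_realization_iff by metis
  \<comment> \<open>The superchannel property ensures that the common output comes from a genuine
    multimeter.\<close>
  moreover obtain M N where "multimeter M" "multimeter N" "\<Psi> (multimeter_choi M) = multimeter_choi N"
    using assms(1) multimeter_deterministic unfolding superchannel_def by blast
  ultimately show ?thesis unfolding trash_and_prepare_def by metis
qed

lemma trash_and_prepare_fix_outcome:
  assumes trash: "trash_and_prepare \<Psi>" and real: "classical_realization \<Psi> s \<Lambda> \<nu>"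
  shows "classical_realization \<Psi> s \<Lambda> (\<lambda>_. \<nu> a\<^sub>0)"
proof -
  let ?D = "deterministic_multimeter (\<lambda>_. a\<^sub>0)"
  have inst: "\<forall>y. instrument (UNIV \<times> {1..s}) (\<Lambda> y)"
    using real by (simp add: classical_realization_iff)
  have "\<Psi> (multimeter_choi M) = multimeter_choi (simulated s \<Lambda> (\<lambda>_. \<nu> a\<^sub>0) M)"
    if M: "multimeter M" for M
  proof -
    have "\<Psi> (multimeter_choi M) = \<Psi> (multimeter_choi ?D)"
      using trash M multimeter_deterministic unfolding trash_and_prepare_def by metis
    also have "\<dots> = multimeter_choi (simulated s \<Lambda> \<nu> ?D)"
      using real multimeter_deterministic unfolding classical_realization_iff by blast
    \<comment> \<open>On \<open>?D\<close> only the outcome \<open>a\<^sub>0\<close> contributes, so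
      the two post-processings cannot be told apart.\<close>
    also have "simulated s \<Lambda> \<nu> ?D = simulated s \<Lambda> (\<lambda>_. \<nu> a\<^sub>0) ?D"
      by (simp add: fun_eq_iff simulated_deterministic[OF inst])
    also have "\<dots> = simulated s \<Lambda> (\<lambda>_. \<nu> a\<^sub>0) M"
      using simulated_independent[OF inst _ M, of "\<lambda>_. \<nu> a\<^sub>0" "\<lambda>_. a\<^sub>0"]
      by (simp add: independent_of_outcome_def)
    finally show ?thesis .
  qed
  with inst show ?thesis by (simp add: classical_realization_iff)
qed

lemma trash_and_prepare_trivial_ancilla:
  assumes trash: "trash_and_prepare \<Psi>" and real: "classical_realization \<Psi> 1 \<Lambda> \<nu>"
    and nonzero: "\<Lambda> y (x, 1) \<noteq> (\<lambda>X. 0)"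
  shows "\<nu> a x y 1 = \<nu> a\<^sub>0 x y 1"
proof (rule pmf_eqI)
  fix b
  let ?f = "(\<lambda>_. a\<^sub>0)(x := a)"
  have inst: "\<forall>y. instrument (UNIV \<times> {1..1}) (\<Lambda> y)"
    using real by (simp add: classical_realization_iff)
  have "completely_positive (\<Lambda> y (x, 1))"
    using instrument_completely_positive[OF inst] by simp
  with nonzero have dual: "dual_map (\<Lambda> y (x, 1)) (mat 1) \<noteq> 0"
    using completely_positive_eq_zero by blast
  have "multimeter_choi (simulated 1 \<Lambda> \<nu> (deterministic_multimeter f)) =
      \<Psi> (multimeter_choi (deterministic_multimeter f))" for f
    using real multimeter_deterministic unfolding classical_realization_iff by metis
  moreover have "\<Psi> (multimeter_choi (deterministic_multimeter ?f)) =
      \<Psi> (multimeter_choi (deterministic_multimeter (\<lambda>_. a\<^sub>0)))"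
    using trash multimeter_deterministic unfolding trash_and_prepare_def by metis
  ultimately have "simulated 1 \<Lambda> \<nu> (deterministic_multimeter ?f) =
      simulated 1 \<Lambda> \<nu> (deterministic_multimeter (\<lambda>_. a\<^sub>0))"
    by (intro multimeter_choi_inj) simp
  \<comment> \<open>With one ancilla value each setting gives a single term; a longer ancilla would
    only allow comparing sums over \<open>c\<close>.\<close>
  then have "(\<Sum>x'\<in>UNIV. pmf (\<nu> (?f x') x' y 1) b *\<^sub>R dual_map (\<Lambda> y (x', 1)) (mat 1)) =
      (\<Sum>x'\<in>UNIV. pmf (\<nu> a\<^sub>0 x' y 1) b *\<^sub>R dual_map (\<Lambda> y (x', 1)) (mat 1))"
    using simulated_deterministic[OF inst, of \<nu> ?f y b]
      simulated_deterministic[OF inst, of \<nu> "\<lambda>_. a\<^sub>0" y b] by simp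
  \<comment> \<open>The terms with \<open>x'\<close> different from \<open>x\<close> agree on both
    sides and cancel.\<close>
  then have "pmf (\<nu> a x y 1) b *\<^sub>R dual_map (\<Lambda> y (x, 1)) (mat 1) =
      pmf (\<nu> a\<^sub>0 x y 1) b *\<^sub>R dual_map (\<Lambda> y (x, 1)) (mat 1)"
    by (simp add: sum.remove[of UNIV x])
  with dual show "pmf (\<nu> a x y 1) b = pmf (\<nu> a\<^sub>0 x y 1) b" by simp
qed

theorem theorem6p8:
  fixes \<Psi> :: "complex^('k::finite \<times> 'd::finite \<times> 'g::finite)^('k \<times> 'd \<times> 'g)
                \<Rightarrow> complex^('l::finite \<times> 'n::finite \<times> 'r::finite)^('l \<times> 'n \<times> 'r)"
    and s :: nat
    and \<Lambda> :: "'r \<Rightarrow> 'g \<times> nat \<Rightarrow> complex^'n^'n \<Rightarrow> complex^'d^'d"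
    and \<nu>' :: "'k \<Rightarrow> 'g \<Rightarrow> 'r \<Rightarrow> nat \<Rightarrow> 'l pmf"
  assumes "superchannel \<Psi>"
    and "classical_realization \<Psi> s \<Lambda> \<nu>'"
  shows "(trash_and_prepare \<Psi> \<longleftrightarrow>
            (\<exists>t \<Gamma> \<nu>. classical_realization \<Psi> t \<Gamma> \<nu> \<and> independent_of_outcome t \<nu>)) \<and>
         (trash_and_prepare \<Psi> \<longleftrightarrow>
            (\<exists>\<nu>. classical_realization \<Psi> s \<Lambda> \<nu> \<and> independent_of_outcome s \<nu>)) \<and>
         (s = 1 \<longrightarrow>
           (trash_and_prepare \<Psi> \<longleftrightarrow>
              (\<exists>\<nu>. classical_realization \<Psi> s \<Lambda> \<nu> \<and> independent_of_outcome s \<nu> \<and>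
                 (\<forall>x y. \<Lambda> y (x, 1) \<noteq> (\<lambda>X. 0) \<longrightarrow> (\<forall>a. \<nu> a x y 1 = \<nu>' a x y 1)))))"
proof -
  \<comment> \<open>The outcome \<open>undefined\<close> plays the role of \<open>a\<^sub>0\<close>;
    this one witness serves all three equivalences.\<close>
  let ?\<nu> = "\<lambda>_ :: 'k. \<nu>' undefined"
  have indep: "independent_of_outcome s ?\<nu>"
    by (simp add: independent_of_outcome_def)
  have real: "classical_realization \<Psi> s \<Lambda> ?\<nu>" if "trash_and_prepare \<Psi>"
    using trash_and_prepare_fix_outcome[OF that assms(2)] .
  have same: "\<forall>x y. \<Lambda> y (x, 1) \<noteq> (\<lambda>X. 0) \<longrightarrow> (\<forall>a. ?\<nu> a x y 1 = \<nu>' a x y 1)"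
    if "trash_and_prepare \<Psi>" "s = 1"
    using trash_and_prepare_trivial_ancilla[OF that(1)] assms(2) that(2) by metis
  have only_if: "trash_and_prepare \<Psi>"
    if "classical_realization \<Psi> t \<Gamma> \<nu> \<and> independent_of_outcome t \<nu>" for t \<Gamma> \<nu>
    using independent_imp_trash_and_prepare[OF assms(1)] that by blast
  show ?thesis
  proof (intro conjI impI iffI)
    assume trash: "trash_and_prepare \<Psi>"
    show "\<exists>\<nu>. classical_realization \<Psi> s \<Lambda> \<nu> \<and> independent_of_outcome s \<nu>"
      using indep real[OF trash] by blast
    then show "\<exists>t \<Gamma> \<nu>. classical_realization \<Psi> t \<Gamma> \<nu> \<and> independent_of_outcome t \<nu>"
      by blast
    assume "s = 1"
    show "\<exists>\<nu>. classical_realization \<Psi> s \<Lambda> \<nu> \<and> independent_of_outcome s \<nu> \<and>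
        (\<forall>x y. \<Lambda> y (x, 1) \<noteq> (\<lambda>X. 0) \<longrightarrow> (\<forall>a. \<nu> a x y 1 = \<nu>' a x y 1))"
      by (intro exI[of _ ?\<nu>] conjI real[OF trash] indep same[OF trash \<open>s = 1\<close>])
  qed (use only_if in blast)+
qed

end
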